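(* Let $R$ be an integral domain and let $\star$ be a semistar operation of finite type on $R$. If $R$ satisfies the ascending chain condition on radical quasi-$\star$-ideals, then for every nonzero ideal $I$ of $R$ the set $\star\text{-}\operatorname{Min}(I)$ of minimal quasi-$\star$-prime ideals over $I$ is finite.
   Context: $R$ is a commutative integral domain with identity and quotient field $K$. Let $\overline{\mathcal{F}}(R)$ be the set of all nonzero $R$-submodules of $K$, and $f(R)$ the set of all nonzero finitely generated fractional ideals of $R$ (i.e. nonzero finitely generated $R$-submodules of $K$). A semistar operation on $R$ is a map $\star:\overline{\mathcal{F}}(R)\to\overline{\mathcal{F}}(R)$, $E\mapsto E^{\star}$, such that for all $0\neq x\in K$ and all $E,F\in\overline{\mathcal{F}}(R)$: (1) $(xE)^{\star}=xE^{\star}$; (2) $E\subseteq F$ implies $E^{\star}\subseteq F^{\star}$; (3) $E\subseteq E^{\star}$ and $(E^{\star})^{\star}=E^{\star}$. The operation $\star_f$ is defined by $E^{\star_f}=\bigcup\{F^{\star} : F\in f(R), F\subseteq E\}$; it is again a semistar operation, and $\star$ is of finite type if $\star=\star_f$. A nonzero ideal $I$ of $R$ is a quasi-$\star$-ideal if $I^{\star}\cap R=I$; it is a radical quasi-$\star$-ideal if moreover $I=\sqrt I$. A quasi-$\star$-prime ideal is a prime ideal that is also a quasi-$\star$-ideal. $\star\text{-}\operatorname{Min}(I)$ denotes the set of quasi-$\star$-prime ideals of $R$ containing $I$ that are minimal (under inclusion) among all quasi-$\star$-prime ideals containing $I$. *)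

theory Defs
  imports "HOL-Algebra.Algebra"
begin

text \<open>
  The integral domain is a subset \<open>R\<close> of the carrier of a field \<open>K\<close>, with the operations of
  \<open>K\<close>; as a ring of its own it is \<open>K\<lparr>carrier := R\<rparr>\<close>.
\<close>

definition is_quotient_field :: "('a, 'm) ring_scheme \<Rightarrow> 'a set \<Rightarrow> bool" where
  "is_quotient_field K R \<longleftrightarrow>
     field K \<and> subdomain R K \<and>
     (\<forall>x\<in>carrier K. \<exists>a\<in>R. \<exists>b\<in>R - {\<zero>\<^bsub>K\<^esub>}. x = a \<otimes>\<^bsub>K\<^esub> inv\<^bsub>K\<^esub> b)"

text \<open>\<open>K\<close> as a module over any of its subrings: the scalar action is the multiplication of \<open>K\<close>.\<close>

definition self_module :: "('a, 'm) ring_scheme \<Rightarrow> ('a, 'a) module" where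
  "self_module K =
     \<lparr>carrier = carrier K, monoid.mult = monoid.mult K, one = one K,
      ring.zero = ring.zero K, add = add K, smult = monoid.mult K\<rparr>"

definition submodules :: "('a, 'm) ring_scheme \<Rightarrow> 'a set \<Rightarrow> 'a set set" where
  "submodules K R = {E. submodule E (K\<lparr>carrier := R\<rparr>) (self_module K)}"

definition nonzero_submodules :: "('a, 'm) ring_scheme \<Rightarrow> 'a set \<Rightarrow> 'a set set" where
  "nonzero_submodules K R = {E \<in> submodules K R. E \<noteq> {\<zero>\<^bsub>K\<^esub>}}"

definition fg_fractional_ideals :: "('a, 'm) ring_scheme \<Rightarrow> 'a set \<Rightarrow> 'a set set" where
  "fg_fractional_ideals K R =
     {F \<in> nonzero_submodules K R.
        \<exists>S. finite S \<and> S \<subseteq> carrier K \<and> F = \<Inter>{M \<in> submodules K R. S \<subseteq> M}}"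

text \<open>
  A semistar operation is a total function on sets, of which only the restriction to
  \<open>nonzero_submodules K R\<close> is constrained. \<open>x <#\<^bsub>K\<^esub> E\<close> is the set \<open>xE\<close>.
\<close>

definition semistar_operation ::
    "('a, 'm) ring_scheme \<Rightarrow> 'a set \<Rightarrow> ('a set \<Rightarrow> 'a set) \<Rightarrow> bool" where
  "semistar_operation K R star \<longleftrightarrow>
     (\<forall>E\<in>nonzero_submodules K R. star E \<in> nonzero_submodules K R) \<and>
     (\<forall>x\<in>carrier K - {\<zero>\<^bsub>K\<^esub>}. \<forall>E\<in>nonzero_submodules K R.
        star (x <#\<^bsub>K\<^esub> E) = x <#\<^bsub>K\<^esub> star E) \<and>
     (\<forall>E\<in>nonzero_submodules K R. \<forall>F\<in>nonzero_submodules K R.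
        E \<subseteq> F \<longrightarrow> star E \<subseteq> star F) \<and>
     (\<forall>E\<in>nonzero_submodules K R. E \<subseteq> star E \<and> star (star E) = star E)"

definition star_f ::
    "('a, 'm) ring_scheme \<Rightarrow> 'a set \<Rightarrow> ('a set \<Rightarrow> 'a set) \<Rightarrow> 'a set \<Rightarrow> 'a set" where
  "star_f K R star E = \<Union>{star F | F. F \<in> fg_fractional_ideals K R \<and> F \<subseteq> E}"

definition finite_type ::
    "('a, 'm) ring_scheme \<Rightarrow> 'a set \<Rightarrow> ('a set \<Rightarrow> 'a set) \<Rightarrow> bool" where
  "finite_type K R star \<longleftrightarrow> (\<forall>E\<in>nonzero_submodules K R. star E = star_f K R star E)"

definition nonzero_ideal :: "('a, 'm) ring_scheme \<Rightarrow> 'a set \<Rightarrow> 'a set \<Rightarrow> bool" where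
  "nonzero_ideal K R I \<longleftrightarrow> ideal I (K\<lparr>carrier := R\<rparr>) \<and> I \<noteq> {\<zero>\<^bsub>K\<^esub>}"

text \<open>Quasi-star-ideals need not be proper: \<open>R\<close> itself is one.\<close>

definition quasi_star_ideal ::
    "('a, 'm) ring_scheme \<Rightarrow> 'a set \<Rightarrow> ('a set \<Rightarrow> 'a set) \<Rightarrow> 'a set \<Rightarrow> bool" where
  "quasi_star_ideal K R star I \<longleftrightarrow> nonzero_ideal K R I \<and> star I \<inter> R = I"

definition radical :: "('a, 'm) ring_scheme \<Rightarrow> 'a set \<Rightarrow> 'a set \<Rightarrow> 'a set" where
  "radical K R I = {x \<in> R. \<exists>n::nat. n > 0 \<and> x [^]\<^bsub>K\<^esub> n \<in> I}"

definition radical_quasi_star_ideal ::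
    "('a, 'm) ring_scheme \<Rightarrow> 'a set \<Rightarrow> ('a set \<Rightarrow> 'a set) \<Rightarrow> 'a set \<Rightarrow> bool" where
  "radical_quasi_star_ideal K R star I \<longleftrightarrow> quasi_star_ideal K R star I \<and> I = radical K R I"

definition acc_radical_quasi_star_ideals ::
    "('a, 'm) ring_scheme \<Rightarrow> 'a set \<Rightarrow> ('a set \<Rightarrow> 'a set) \<Rightarrow> bool" where
  "acc_radical_quasi_star_ideals K R star \<longleftrightarrow>
     (\<forall>J :: nat \<Rightarrow> 'a set.
        (\<forall>n. radical_quasi_star_ideal K R star (J n)) \<and> (\<forall>n. J n \<subseteq> J (Suc n)) \<longrightarrow>
        (\<exists>N. \<forall>n\<ge>N. J n = J N))"

definition quasi_star_prime ::
    "('a, 'm) ring_scheme \<Rightarrow> 'a set \<Rightarrow> ('a set \<Rightarrow> 'a set) \<Rightarrow> 'a set \<Rightarrow> bool" where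
  "quasi_star_prime K R star P \<longleftrightarrow>
     primeideal P (K\<lparr>carrier := R\<rparr>) \<and> quasi_star_ideal K R star P"

definition star_Min ::
    "('a, 'm) ring_scheme \<Rightarrow> 'a set \<Rightarrow> ('a set \<Rightarrow> 'a set) \<Rightarrow> 'a set \<Rightarrow> 'a set set" where
  "star_Min K R star I =
     {P. quasi_star_prime K R star P \<and> I \<subseteq> P \<and>
         (\<forall>Q. quasi_star_prime K R star Q \<and> I \<subseteq> Q \<and> Q \<subseteq> P \<longrightarrow> Q = P)}"

end

theory Submission
  imports Defs
begin

text \<open>
  Write \<open>H(S)\<close> for the intersection of all radical quasi-star-ideals containing \<open>S\<close>. Monotonicity
  of the star operation makes it a radical quasi-star-ideal
  (\<open>radical_quasi_star_ideal_hull\<close>), and every quasi-star-prime is a radical quasi-star-ideal,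
  so that \<open>S\<close> and \<open>H(S)\<close> lie in the same quasi-star-primes and have the same minimal ones
  (\<open>star_Min_hull\<close>). It is therefore enough to treat radical quasi-star-ideals \<open>J\<close>.

  For these the chain condition permits Noetherian induction, as for minimal primes in a
  Noetherian ring. If \<open>J = R\<close>, no prime contains \<open>J\<close>; if \<open>J\<close> is prime, it is its only
  minimal quasi-star-prime. Otherwise \<open>ab \<in> J\<close> for some \<open>a, b \<in> R - J\<close>. Every prime
  over \<open>J\<close> contains \<open>a\<close> or \<open>b\<close>, so every minimal quasi-star-prime over \<open>J\<close> is one over
  \<open>J \<union> {a}\<close> or \<open>J \<union> {b}\<close>, equivalently over one of the strictly larger hulls
  \<open>H(J \<union> {a})\<close>, \<open>H(J \<union> {b})\<close>; both have only finitely many by induction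
  (\<open>finite_star_Min_radical\<close>).
\<close>

lemma quotient_fieldD:
  assumes "is_quotient_field K R"
  shows "field K" "domain (K\<lparr>carrier := R\<rparr>)" "R \<subseteq> carrier K"
proof -
  show K: "field K" using assms by (simp add: is_quotient_field_def)
  interpret field K by (rule K)
  have sd: "subdomain R K" using assms by (simp add: is_quotient_field_def)
  show "domain (K\<lparr>carrier := R\<rparr>)" by (rule subdomain_is_domain[OF sd])
  show "R \<subseteq> carrier K" by (rule subdomainE(1)[OF sd])
qed

text \<open>
  The axioms of a semistar operation speak about submodules of the quotient field; this makes
  them applicable to ideals of \<open>R\<close>.
\<close>

lemma ideal_imp_submodule:
  assumes "is_quotient_field K R" "ideal I (K\<lparr>carrier := R\<rparr>)"
  shows "I \<in> submodules K R"
proof -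
  interpret field K by (rule quotient_fieldD(1)[OF assms(1)])
  note RK = quotient_fieldD(3)[OF assms(1)]
  interpret I: ideal I "K\<lparr>carrier := R\<rparr>" by (rule assms(2))
  have IR: "I \<subseteq> R" using I.a_subset by simp
  hence IK: "I \<subseteq> carrier K" using RK by blast
  have inv: "inv\<^bsub>add_monoid K\<^esub> a \<in> I" if "a \<in> I" for a
  proof -
    let ?b = "\<ominus>\<^bsub>K\<lparr>carrier := R\<rparr>\<^esub> a"
    have b: "?b \<in> I" using I.a_inv_closed that by simp
    have "?b \<oplus>\<^bsub>K\<^esub> a = \<zero>\<^bsub>K\<^esub>" using I.l_neg[of a] that IR by auto
    hence "\<ominus>\<^bsub>K\<^esub> a = ?b" using b that IK by (intro minus_equality) auto
    thus ?thesis using b by (simp add: a_inv_def)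
  qed
  have "inv\<^bsub>add_monoid (self_module K)\<^esub> a = inv\<^bsub>add_monoid K\<^esub> a" for a
    by (simp add: m_inv_def self_module_def)
  hence "subgroup I (add_monoid (self_module K))"
    using additive_subgroup.a_closed[OF I.additive_subgroup_axioms]
      additive_subgroup.zero_closed[OF I.additive_subgroup_axioms] inv IK
    by (intro subgroup.intro) (auto simp: self_module_def)
  moreover have "a \<otimes>\<^bsub>K\<^esub> x \<in> I" if "a \<in> R" "x \<in> I" for a x
    using I.I_l_closed[of x a] that by simp
  ultimately show ?thesis
    by (auto simp: submodules_def submodule_def submodule_axioms_def self_module_def)
qed

lemma subset_radical:
  assumes "is_quotient_field K R" "S \<subseteq> R"
  shows "S \<subseteq> radical K R S"
proof
  interpret field K by (rule quotient_fieldD(1)[OF assms(1)])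
  fix x assume x: "x \<in> S"
  hence "x [^]\<^bsub>K\<^esub> (1::nat) \<in> S" using quotient_fieldD(3)[OF assms(1)] assms(2) by auto
  thus "x \<in> radical K R S" using x assms(2) zero_less_one unfolding radical_def by blast
qed

text \<open>Guarantees that the intersections that define hulls are over nonempty families.\<close>

lemma carrier_radical_quasi_star_ideal:
  assumes "is_quotient_field K R" "semistar_operation K R star"
  shows "radical_quasi_star_ideal K R star R"
proof -
  interpret R: domain "K\<lparr>carrier := R\<rparr>" by (rule quotient_fieldD(2)[OF assms(1)])
  have id: "nonzero_ideal K R R"
    using R.oneideal R.one_not_zero R.one_closed unfolding nonzero_ideal_def by auto
  hence "R \<in> nonzero_submodules K R"
    using ideal_imp_submodule[OF assms(1)] by (auto simp: nonzero_submodules_def nonzero_ideal_def)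
  hence "R \<subseteq> star R" using assms(2) by (auto simp: semistar_operation_def)
  moreover have "R = radical K R R"
    using subset_radical[OF assms(1) order_refl] by (auto simp: radical_def)
  ultimately show ?thesis using id
    by (auto simp: radical_quasi_star_ideal_def quasi_star_ideal_def)
qed

text \<open>
  By monotonicity, the star closure of the intersection, cut down to \<open>R\<close>, lies in every member
  of the family; likewise for the radical. The intersection must be nonzero, as the star
  operation is unconstrained on the zero module.
\<close>

lemma Inter_radical_quasi_star_ideal:
  assumes qf: "is_quotient_field K R" and ss: "semistar_operation K R star"
    and ne: "\<J> \<noteq> {}" and all: "\<And>J. J \<in> \<J> \<Longrightarrow> radical_quasi_star_ideal K R star J"
    and nz: "\<not> \<Inter>\<J> \<subseteq> {\<zero>\<^bsub>K\<^esub>}"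
  shows "radical_quasi_star_ideal K R star (\<Inter>\<J>)"
proof -
  interpret R: domain "K\<lparr>carrier := R\<rparr>" by (rule quotient_fieldD(2)[OF qf])
  have ids: "ideal J (K\<lparr>carrier := R\<rparr>)" "star J \<inter> R = J" "radical K R J = J"
    "J \<in> nonzero_submodules K R" if "J \<in> \<J>" for J
    using all[OF that] ideal_imp_submodule[OF qf]
    by (auto simp: radical_quasi_star_ideal_def quasi_star_ideal_def nonzero_ideal_def
          nonzero_submodules_def)
  have id: "ideal (\<Inter>\<J>) (K\<lparr>carrier := R\<rparr>)"
    using R.i_Intersect[of \<J>] ids(1) ne by blast
  have sub: "\<Inter>\<J> \<in> nonzero_submodules K R"
    using ideal_imp_submodule[OF qf id] nz by (auto simp: nonzero_submodules_def)
  have "\<Inter>\<J> \<subseteq> star (\<Inter>\<J>)" using ss sub by (auto simp: semistar_operation_def)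
  moreover have "\<Inter>\<J> \<subseteq> R" using ne ids(2) by blast
  moreover have "star (\<Inter>\<J>) \<inter> R \<subseteq> J" if "J \<in> \<J>" for J
  proof -
    have "star (\<Inter>\<J>) \<subseteq> star J"
      using ss sub ids(4)[OF that] that Inter_lower[OF that] unfolding semistar_operation_def by blast
    thus ?thesis using ids(2)[OF that] by blast
  qed
  ultimately have st: "star (\<Inter>\<J>) \<inter> R = \<Inter>\<J>" by blast
  have "radical K R (\<Inter>\<J>) \<subseteq> J" if "J \<in> \<J>" for J
    using ids(3)[OF that] that unfolding radical_def by blast
  moreover have "\<Inter>\<J> \<subseteq> radical K R (\<Inter>\<J>)"
    using subset_radical[OF qf \<open>\<Inter>\<J> \<subseteq> R\<close>] .
  ultimately show ?thesis
    using id st nz by (auto simp: radical_quasi_star_ideal_def quasi_star_ideal_def nonzero_ideal_def)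
qed

lemma prime_radical_quasi_star_ideal:
  assumes qf: "is_quotient_field K R" and P: "quasi_star_prime K R star P"
  shows "radical_quasi_star_ideal K R star P"
proof -
  interpret field K by (rule quotient_fieldD(1)[OF qf])
  interpret P: primeideal P "K\<lparr>carrier := R\<rparr>" using P by (simp add: quasi_star_prime_def)
  have PR: "P \<subseteq> R" using P.a_subset by simp
  have pow: "x \<in> P" if "x \<in> R" "x [^]\<^bsub>K\<^esub> (n::nat) \<in> P" for x n
    using that(2)
  proof (induction n)
    case 0
    hence "P = R" using P.one_imp_carrier by simp
    thus ?case using that(1) by simp
  next
    case (Suc n)
    have "x [^]\<^bsub>K\<lparr>carrier := R\<rparr>\<^esub> n \<in> R" using P.nat_pow_closed[of x n] that(1) by simp
    hence "x [^]\<^bsub>K\<^esub> n \<in> R" using nat_pow_consistent by metis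
    thus ?case using Suc P.I_prime[of "x [^]\<^bsub>K\<^esub> n" x] that(1) by auto
  qed
  have "P \<subseteq> radical K R P" by (rule subset_radical[OF qf PR])
  moreover have "radical K R P \<subseteq> P" using pow by (auto simp: radical_def)
  ultimately show ?thesis using P by (auto simp: radical_quasi_star_ideal_def quasi_star_prime_def)
qed

text \<open>
  The argument \<open>S\<close> is an arbitrary set, so that an element can be adjoined to an ideal without
  first forming a sum of ideals.
\<close>

definition radical_star_hull ::
    "('a, 'm) ring_scheme \<Rightarrow> 'a set \<Rightarrow> ('a set \<Rightarrow> 'a set) \<Rightarrow> 'a set \<Rightarrow> 'a set" where
  "radical_star_hull K R star S = \<Inter>{J. radical_quasi_star_ideal K R star J \<and> S \<subseteq> J}"

lemma radical_star_hull_subset_iff: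
  assumes "is_quotient_field K R" "quasi_star_prime K R star P"
  shows "radical_star_hull K R star S \<subseteq> P \<longleftrightarrow> S \<subseteq> P"
  using prime_radical_quasi_star_ideal[OF assms] unfolding radical_star_hull_def by blast

lemma radical_star_hull_superset: "S \<subseteq> radical_star_hull K R star S"
  unfolding radical_star_hull_def by blast

lemma radical_quasi_star_ideal_hull:
  assumes "is_quotient_field K R" "semistar_operation K R star"
    and "S \<subseteq> R" "\<not> S \<subseteq> {\<zero>\<^bsub>K\<^esub>}"
  shows "radical_quasi_star_ideal K R star (radical_star_hull K R star S)"
  unfolding radical_star_hull_def
  using carrier_radical_quasi_star_ideal[OF assms(1,2)] assms(3,4)
  by (intro Inter_radical_quasi_star_ideal[OF assms(1,2)]) blast+

lemma star_Min_hull: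
  assumes "is_quotient_field K R"
  shows "star_Min K R star (radical_star_hull K R star S) = star_Min K R star S"
  by (simp add: star_Min_def radical_star_hull_subset_iff[OF assms] cong: conj_cong)

lemma nonzero_idealD:
  assumes "nonzero_ideal K R I"
  shows "I \<subseteq> R" "\<not> I \<subseteq> {\<zero>\<^bsub>K\<^esub>}"
proof -
  interpret I: ideal I "K\<lparr>carrier := R\<rparr>" using assms by (simp add: nonzero_ideal_def)
  show "I \<subseteq> R" using I.a_subset by simp
  show "\<not> I \<subseteq> {\<zero>\<^bsub>K\<^esub>}" using additive_subgroup.zero_closed[OF I.additive_subgroup_axioms] assms
    by (auto simp: nonzero_ideal_def)
qed

text \<open>
  A prime over \<open>J\<close> contains \<open>a\<close> or \<open>b\<close>, and minimality over \<open>J\<close> passes to any set between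
  \<open>J\<close> and that prime.
\<close>

lemma star_Min_insert_cover:
  assumes "a \<in> R" "b \<in> R" "a \<otimes>\<^bsub>K\<^esub> b \<in> J"
  shows "star_Min K R star J \<subseteq> star_Min K R star (insert a J) \<union> star_Min K R star (insert b J)"
proof
  fix P assume P: "P \<in> star_Min K R star J"
  interpret P: primeideal P "K\<lparr>carrier := R\<rparr>"
    using P by (simp add: star_Min_def quasi_star_prime_def)
  have "a \<otimes>\<^bsub>K\<^esub> b \<in> P" using P assms(3) by (auto simp: star_Min_def)
  hence "a \<in> P \<or> b \<in> P" using P.I_prime[of a b] assms(1,2) by auto
  thus "P \<in> star_Min K R star (insert a J) \<union> star_Min K R star (insert b J)"
    using P unfolding star_Min_def by auto
qed

lemma wf_radical_quasi_star_ideals: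
  assumes "acc_radical_quasi_star_ideals K R star"
  shows "wf {(J', J). radical_quasi_star_ideal K R star J' \<and> radical_quasi_star_ideal K R star J
                      \<and> J \<subset> J'}"
  unfolding wf_iff_no_infinite_down_chain
proof
  assume "\<exists>f. \<forall>i. (f (Suc i), f i) \<in> {(J', J). radical_quasi_star_ideal K R star J'
            \<and> radical_quasi_star_ideal K R star J \<and> J \<subset> J'}"
  then obtain f where f: "\<And>i. radical_quasi_star_ideal K R star (f i)" "\<And>i. f i \<subset> f (Suc i)"
    by blast
  hence "\<exists>N. \<forall>n\<ge>N. f n = f N"
    using assms[unfolded acc_radical_quasi_star_ideals_def, rule_format, of f] f(2)
    by (simp only: psubset_eq simp_thms)
  then obtain N where N: "\<forall>n\<ge>N. f n = f N" by blast
  have "f (Suc N) = f N" by (rule N[rule_format]) simp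
  thus False using f(2)[of N] by simp
qed

lemma finite_star_Min_radical:
  assumes qf: "is_quotient_field K R" and ss: "semistar_operation K R star"
    and acc: "acc_radical_quasi_star_ideals K R star"
  shows "radical_quasi_star_ideal K R star J \<Longrightarrow> finite (star_Min K R star J)"
proof (induction J rule: wf_induct_rule[OF wf_radical_quasi_star_ideals[OF acc]])
  case (1 J)
  have qJ: "quasi_star_ideal K R star J" and nJ: "nonzero_ideal K R J"
    using 1(2) by (auto simp: radical_quasi_star_ideal_def quasi_star_ideal_def)
  note J = nonzero_idealD[OF nJ]
  have cr: "cring (K\<lparr>carrier := R\<rparr>)"
    using quotient_fieldD(2)[OF qf] by (rule domain.axioms(1))
  have step: "finite (star_Min K R star (insert a J))" if "a \<in> R" "a \<notin> J" for a
  proof -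
    let ?H = "radical_star_hull K R star (insert a J)"
    have H: "radical_quasi_star_ideal K R star ?H"
      using J that by (intro radical_quasi_star_ideal_hull[OF qf ss]) auto
    have "J \<subset> ?H" using radical_star_hull_superset[of "insert a J"] that(2) by blast
    hence "finite (star_Min K R star ?H)" using 1 H by blast
    thus ?thesis by (simp add: star_Min_hull[OF qf])
  qed
  show ?case
  proof (cases "primeideal J (K\<lparr>carrier := R\<rparr>)")
    case True
    hence "star_Min K R star J \<subseteq> {J}" using qJ by (auto simp: star_Min_def quasi_star_prime_def)
    thus ?thesis by (rule finite_subset) simp
  next
    case not_prime: False
    have idJ: "ideal J (K\<lparr>carrier := R\<rparr>)" using nJ by (simp add: nonzero_ideal_def)
    show ?thesis
    proof (cases "J = R")
      case True
      have "star_Min K R star J = {}"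
      proof (rule ccontr)
        assume "star_Min K R star J \<noteq> {}"
        then obtain P where P: "primeideal P (K\<lparr>carrier := R\<rparr>)" "R \<subseteq> P"
          using True by (auto simp: star_Min_def quasi_star_prime_def)
        interpret P: primeideal P "K\<lparr>carrier := R\<rparr>" by (rule P(1))
        show False using P.I_notcarr P.a_subset P(2) by auto
      qed
      thus ?thesis by simp
    next
      case False
      then obtain a b where "a \<in> R" "b \<in> R" "a \<otimes>\<^bsub>K\<^esub> b \<in> J" "a \<notin> J" "b \<notin> J"
        using not_prime primeidealI[OF idJ cr] by auto
      thus ?thesis
        using finite_subset[OF star_Min_insert_cover[of a R b K J star]] step by blast
    qed
  qed
qed

theorem corollary2p11:
  fixes K :: "('a, 'm) ring_scheme"
    and R :: "'a set"
    and star :: "'a set \<Rightarrow> 'a set"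
  assumes "is_quotient_field K R"
    and "semistar_operation K R star"
    and "finite_type K R star"
    and "acc_radical_quasi_star_ideals K R star"
  shows "\<forall>I. nonzero_ideal K R I \<longrightarrow> finite (star_Min K R star I)"
proof (intro allI impI)
  fix I assume I: "nonzero_ideal K R I"
  have "radical_quasi_star_ideal K R star (radical_star_hull K R star I)"
    by (rule radical_quasi_star_ideal_hull[OF assms(1,2) nonzero_idealD[OF I]])
  hence "finite (star_Min K R star (radical_star_hull K R star I))"
    by (rule finite_star_Min_radical[OF assms(1,2,4)])
  thus "finite (star_Min K R star I)" by (simp add: star_Min_hull[OF assms(1)])
qed

end
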